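(* Fix integers $c,c'\ge0$. For $m,n\in\mathbb{N}$ let $A_m=\mathbb{K}[x_i^2,x_ix_{i+1},\dots,x_ix_{i+c}: i\in[m]]\subseteq\mathbb{K}[x_1,\dots,x_{m+c}]$ and $B_n=\mathbb{K}[y_i^2,y_iy_{i+1},\dots,y_iy_{i+c'}: i\in[n]]\subseteq\mathbb{K}[y_1,\dots,y_{n+c'}]$. Then $\operatorname{equivH}_{\mathcal{A}\boxtimes\mathcal{B}}(s_1,s_2,t)=\sum_{m,n\in\mathbb{N}}\sum_{d\ge0}\dim_{\mathbb{K}}[A_m\boxtimes B_n]_d\,t^ds_1^ms_2^n$ is a rational function.
   Context: $\mathbb{K}$ is a field. The Segre product $A_m\boxtimes B_n$ is the subalgebra of $\mathbb{K}[x_1,\dots,x_{m+c},y_1,\dots,y_{n+c'}]$ generated by all products $ab$ where $a$ is one of the quadratic monomial generators of $A_m$ listed above and $b$ one of the listed quadratic monomial generators of $B_n$; it is graded so that $[A_m\boxtimes B_n]_d$ consists of its elements of (polynomial) degree $4d$. *)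

theory Defs
  imports Complex_Main "HOL-Library.Poly_Mapping"
begin

text \<open>Variables: Inl i stands for x_i, Inr j stands for y_j.
  A monomial is an exponent vector; a polynomial over the field 'k is a finitely
  supported map from monomials to coefficients (ring structure from Poly_Mapping).\<close>

type_synonym monom = "(nat + nat) \<Rightarrow>\<^sub>0 nat"
type_synonym 'k mpoly = "monom \<Rightarrow>\<^sub>0 'k"

definition pscale :: "'k::field \<Rightarrow> 'k mpoly \<Rightarrow> 'k mpoly" where
  "pscale a p = Poly_Mapping.map (\<lambda>x. a * x) p"

definition quad :: "nat + nat \<Rightarrow> nat + nat \<Rightarrow> 'k::field mpoly" where
  "quad u v = Poly_Mapping.single (Poly_Mapping.single u 1 + Poly_Mapping.single v 1) 1"

definition genA :: "nat \<Rightarrow> nat \<Rightarrow> 'k::field mpoly set" where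
  "genA c m = {quad (Inl i) (Inl j) | i j. 1 \<le> i \<and> i \<le> m \<and> i \<le> j \<and> j \<le> i + c}"

definition genB :: "nat \<Rightarrow> nat \<Rightarrow> 'k::field mpoly set" where
  "genB c' n = {quad (Inr i) (Inr j) | i j. 1 \<le> i \<and> i \<le> n \<and> i \<le> j \<and> j \<le> i + c'}"

definition genSegre :: "nat \<Rightarrow> nat \<Rightarrow> nat \<Rightarrow> nat \<Rightarrow> 'k::field mpoly set" where
  "genSegre c c' m n = {a * b | a b. a \<in> genA c m \<and> b \<in> genB c' n}"

definition subalg :: "'k::field mpoly set \<Rightarrow> 'k mpoly set" where
  "subalg G = module.span pscale {prod_list l | l. set l \<subseteq> G}"

definition mdeg :: "monom \<Rightarrow> nat" where
  "mdeg \<alpha> = (\<Sum>v\<in>Poly_Mapping.keys \<alpha>. Poly_Mapping.lookup \<alpha> v)"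

definition segre_part :: "nat \<Rightarrow> nat \<Rightarrow> nat \<Rightarrow> nat \<Rightarrow> nat \<Rightarrow> 'k::field mpoly set" where
  "segre_part c c' m n d =
     {p \<in> subalg (genSegre c c' m n). \<forall>\<alpha>\<in>Poly_Mapping.keys p. mdeg \<alpha> = 4 * d}"

definition segre_hilb :: "'k::field itself \<Rightarrow> nat \<Rightarrow> nat \<Rightarrow> nat \<Rightarrow> nat \<Rightarrow> nat \<Rightarrow> nat" where
  "segre_hilb _ c c' m n d = vector_space.dim (pscale :: 'k \<Rightarrow> 'k mpoly \<Rightarrow> 'k mpoly) (segre_part c c' m n d)"

text \<open>A formal power series in three variables s1, s2, t, given by its coefficient
  function h m n d (coefficient of s1^m s2^n t^d), is rational if Q * H = P for some
  polynomials P, Q with rational coefficients, Q nonzero.\<close>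
definition rational_series3 :: "(nat \<Rightarrow> nat \<Rightarrow> nat \<Rightarrow> rat) \<Rightarrow> bool" where
  "rational_series3 h \<longleftrightarrow>
     (\<exists>P Q :: nat \<Rightarrow> nat \<Rightarrow> nat \<Rightarrow> rat.
        finite {(i, j, k). P i j k \<noteq> 0} \<and> finite {(i, j, k). Q i j k \<noteq> 0} \<and>
        (\<exists>i j k. Q i j k \<noteq> 0) \<and>
        (\<forall>m n d. (\<Sum>i\<le>m. \<Sum>j\<le>n. \<Sum>k\<le>d. Q i j k * h (m - i) (n - j) (d - k)) = P m n d))"

end

theory Submission
  imports Defs "HOL-Computational_Algebra.Formal_Power_Series" "HOL-Library.Multiset"
begin

text \<open>
  A monomial of \<open>[A_m]_d\<close> is a multiset of vertices that is a sum of \<open>d\<close> edges \<open>p \<le> q \<le> p + c\<close>,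
  \<open>1 \<le> p \<le> m\<close>. Repeatedly splitting off the edge that joins the largest vertex to the largest remaining
  vertex in \<open>[m]\<close> writes it uniquely as a chain of \<open>d\<close> edges. Counting these chains by their last edge,
  the generating functions in \<open>s\<close> of the chains of length \<open>d\<close> with a given upper bound, taken relative to
  \<open>m\<close>, satisfy a finite triangular linear recurrence in \<open>d\<close> over the polynomials in \<open>s\<close>. Since the Hilbert
  function of the Segre product is the product of the two counts, the tensor product of the recurrences
  for \<open>A\<close> (over \<open>s\<^sub>1\<close>) and \<open>B\<close> (over \<open>s\<^sub>2\<close>) governs it, and solving this triangular recurrence gives
  a rational function of \<open>s\<^sub>1\<close>, \<open>s\<^sub>2\<close>, \<open>t\<close>.
\<close>

section \<open>Rational power series from triangular recurrences\<close>

definition is_subring :: "'a::comm_ring_1 set \<Rightarrow> bool" where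
  "is_subring R \<longleftrightarrow> 1 \<in> R \<and> (\<forall>x\<in>R. \<forall>y\<in>R. x - y \<in> R \<and> x * y \<in> R)"

lemma is_subring_UNIV: "is_subring UNIV"
  by (simp add: is_subring_def)

context
  fixes R :: "'a::comm_ring_1 set"
  assumes R: "is_subring R"
begin

lemma is_subring_1: "1 \<in> R"
  and is_subring_diff: "x \<in> R \<Longrightarrow> y \<in> R \<Longrightarrow> x - y \<in> R"
  and is_subring_mult: "x \<in> R \<Longrightarrow> y \<in> R \<Longrightarrow> x * y \<in> R"
  using R by (auto simp: is_subring_def)

lemma is_subring_0: "0 \<in> R"
  using is_subring_diff[OF is_subring_1 is_subring_1] by simp

lemma is_subring_add: "x \<in> R \<Longrightarrow> y \<in> R \<Longrightarrow> x + y \<in> R"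
  using is_subring_diff[of x "0 - y"] is_subring_diff[OF is_subring_0, of y] by simp

lemma is_subring_sum: "(\<And>x. x \<in> A \<Longrightarrow> f x \<in> R) \<Longrightarrow> sum f A \<in> R"
  by (induction A rule: infinite_finite_induct) (auto intro: is_subring_0 is_subring_add)

lemma is_subring_power: "x \<in> R \<Longrightarrow> x ^ n \<in> R"
  by (induction n) (auto intro: is_subring_1 is_subring_mult)

end

lemmas is_subring_intros =
  is_subring_0 is_subring_1 is_subring_diff is_subring_add is_subring_mult
  is_subring_sum is_subring_power

text \<open>The polynomial ring over \<open>R\<close>, kept inside the power series ring so that it
  can be iterated: three nested copies over the rationals are the polynomials in s1, s2, t.\<close>

definition fps_poly_over :: "'a::comm_ring_1 set \<Rightarrow> 'a fps set" where
  "fps_poly_over R = {F. (\<forall>n. fps_nth F n \<in> R) \<and> finite {n. fps_nth F n \<noteq> 0}}"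

lemma is_subring_fps_poly_over:
  fixes R :: "'a::comm_ring_1 set"
  assumes R: "is_subring R"
  shows "is_subring (fps_poly_over R)"
proof -
  have one: "1 \<in> fps_poly_over R"
    using is_subring_0[OF R] is_subring_1[OF R] by (auto simp: fps_poly_over_def)
  have diff: "F - G \<in> fps_poly_over R" if "F \<in> fps_poly_over R" "G \<in> fps_poly_over R" for F G
  proof -
    have "{n. fps_nth (F - G) n \<noteq> 0} \<subseteq> {n. fps_nth F n \<noteq> 0} \<union> {n. fps_nth G n \<noteq> 0}" by auto
    then show ?thesis using that R
      by (auto simp: fps_poly_over_def intro!: is_subring_diff elim: finite_subset)
  qed
  have mult: "F * G \<in> fps_poly_over R" if "F \<in> fps_poly_over R" "G \<in> fps_poly_over R" for F G
  proof -
    let ?S = "\<lambda>F :: 'a fps. {n. fps_nth F n \<noteq> 0}"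
    have "?S (F * G) \<subseteq> (\<lambda>(i, j). i + j) ` (?S F \<times> ?S G)"
    proof
      fix n assume "n \<in> ?S (F * G)"
      then have "(\<Sum>i=0..n. fps_nth F i * fps_nth G (n - i)) \<noteq> 0" by (simp add: fps_mult_nth)
      then obtain i where "i \<in> {0..n}" "fps_nth F i * fps_nth G (n - i) \<noteq> 0"
        by (meson sum.not_neutral_contains_not_neutral)
      then show "n \<in> (\<lambda>(i, j). i + j) ` (?S F \<times> ?S G)"
        by (intro image_eqI[of _ _ "(i, n - i)"]) auto
    qed
    then have "finite (?S (F * G))"
      using that by (auto simp: fps_poly_over_def elim!: finite_subset)
    then show ?thesis using that R
      by (auto simp: fps_poly_over_def fps_mult_nth intro!: is_subring_sum is_subring_mult)
  qed
  show ?thesis unfolding is_subring_def using one diff mult by blast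
qed

lemma fps_const_in_fps_poly_over:
  "is_subring R \<Longrightarrow> x \<in> R \<Longrightarrow> fps_const x \<in> fps_poly_over R"
  using is_subring_0[of R] by (auto simp: fps_poly_over_def fps_const_def)

lemma fps_X_in_fps_poly_over: "is_subring R \<Longrightarrow> fps_X \<in> fps_poly_over R"
  using is_subring_0[of R] is_subring_1[of R] by (auto simp: fps_poly_over_def fps_X_def)

section \<open>Fractions and triangular linear recurrences\<close>

definition rational_over :: "'a::idom set \<Rightarrow> 'a \<Rightarrow> bool" where
  "rational_over R x \<longleftrightarrow> (\<exists>q\<in>R. q \<noteq> 0 \<and> q * x \<in> R)"

context
  fixes R :: "'a::idom set"
  assumes R: "is_subring R"
begin

lemma rational_over_base: "x \<in> R \<Longrightarrow> rational_over R x"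
  unfolding rational_over_def using is_subring_1[OF R] by (intro bexI[of _ 1]) auto

lemma rational_over_add:
  assumes "rational_over R x" "rational_over R y"
  shows "rational_over R (x + y)"
proof -
  obtain p q where pq: "p \<in> R" "p \<noteq> 0" "p * x \<in> R" "q \<in> R" "q \<noteq> 0" "q * y \<in> R"
    using assms by (auto simp: rational_over_def)
  have "(p * q) * (x + y) = q * (p * x) + p * (q * y)" by (simp add: algebra_simps)
  also have "\<dots> \<in> R" using pq is_subring_add[OF R] is_subring_mult[OF R] by metis
  finally show ?thesis
    unfolding rational_over_def using pq by (intro bexI[of _ "p * q"]) (auto intro: is_subring_mult R)
qed

lemma rational_over_mult:
  assumes "x \<in> R" "rational_over R y"
  shows "rational_over R (x * y)"
proof -
  obtain q where q: "q \<in> R" "q \<noteq> 0" "q * y \<in> R" using assms by (auto simp: rational_over_def)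
  have "q * (x * y) = x * (q * y)" by (simp add: algebra_simps)
  then have "q * (x * y) \<in> R" using is_subring_mult[OF R assms(1) q(3)] by (simp only:)
  then show ?thesis using q unfolding rational_over_def by blast
qed

lemma rational_over_sum:
  "(\<And>x. x \<in> A \<Longrightarrow> rational_over R (f x)) \<Longrightarrow> rational_over R (sum f A)"
  by (induction A rule: infinite_finite_induct)
    (auto intro: rational_over_base is_subring_0[OF R] rational_over_add)

lemma rational_over_cancel:
  assumes "p \<in> R" "p \<noteq> 0" "rational_over R (p * x)"
  shows "rational_over R x"
proof -
  obtain q where q: "q \<in> R" "q \<noteq> 0" "q * (p * x) \<in> R" using assms by (auto simp: rational_over_def)
  then have "(q * p) * x \<in> R" by (simp add: mult.assoc)
  then show ?thesis
    unfolding rational_over_def using q assms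
    by (intro bexI[of _ "q * p"]) (auto intro: is_subring_mult R)
qed

end

text \<open>A linear recurrence in \<open>d\<close> whose matrix \<open>k\<close> is triangular for
  the rank \<open>r\<close>. The factors \<open>p x\<close> act as denominators; they stay on the
  left so that all entries lie in \<open>R\<close>.\<close>

definition triangular_system ::
  "'a::idom set \<Rightarrow> 'x set \<Rightarrow> ('x \<Rightarrow> nat) \<Rightarrow> ('x \<Rightarrow> 'a) \<Rightarrow> ('x \<Rightarrow> 'x \<Rightarrow> 'a) \<Rightarrow> ('x \<Rightarrow> nat \<Rightarrow> 'a) \<Rightarrow> bool"
  where "triangular_system R X r p k a \<longleftrightarrow> finite X \<and> (\<forall>x\<in>X.
     p x \<in> R \<and> p x \<noteq> 0 \<and> p x * a x 0 \<in> R \<and>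
     (\<forall>y\<in>X. k x y \<in> R \<and> (k x y \<noteq> 0 \<longrightarrow> y = x \<or> r y < r x)) \<and>
     (\<forall>d. p x * a x (Suc d) = (\<Sum>y\<in>X. k x y * a y d)))"

text \<open>With H(x) the generating function of \<open>a x\<close>, the recurrence reads (p(x) - X
  k(x,x)) H(x) = p(x) a(x,0) + X * (sum over y \<noteq> x of k(x,y) H(y)). The nonzero off-diagonal
  terms have smaller rank, so induction on the rank applies.\<close>

lemma triangular_system_rational:
  fixes R :: "'a::idom set"
  assumes R: "is_subring R" and sys: "triangular_system R X r p k a" and "x \<in> X"
  shows "rational_over (fps_poly_over R) (Abs_fps (a x))"
  using \<open>x \<in> X\<close>
proof (induction "r x" arbitrary: x rule: less_induct)
  case less
  let ?S = "fps_poly_over R"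
  let ?H = "\<lambda>x. Abs_fps (a x)"
  let ?D = "fps_const (p x) - fps_X * fps_const (k x x)"
  note S = is_subring_fps_poly_over[OF R]
  have fin: "finite X" and x: "p x \<in> R" "p x \<noteq> 0" "p x * a x 0 \<in> R"
    and k: "\<And>y. y \<in> X \<Longrightarrow> k x y \<in> R" "\<And>y. y \<in> X \<Longrightarrow> k x y \<noteq> 0 \<Longrightarrow> y = x \<or> r y < r x"
    and rec: "\<And>d. p x * a x (Suc d) = (\<Sum>y\<in>X. k x y * a y d)"
    using sys less.prems unfolding triangular_system_def by blast+
  have "fps_const (p x) * ?H x =
      fps_const (p x * a x 0) + fps_X * (\<Sum>y\<in>X. fps_const (k x y) * ?H y)"
  proof (rule fps_ext)
    fix n
    show "fps_nth (fps_const (p x) * ?H x) n =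
      fps_nth (fps_const (p x * a x 0) + fps_X * (\<Sum>y\<in>X. fps_const (k x y) * ?H y)) n"
      by (cases n) (simp_all add: rec fps_sum_nth)
  qed
  also have "(\<Sum>y\<in>X. fps_const (k x y) * ?H y) =
      fps_const (k x x) * ?H x + (\<Sum>y\<in>X - {x}. fps_const (k x y) * ?H y)"
    using fin less.prems by (rule sum.remove)
  finally have eq: "?D * ?H x =
      fps_const (p x * a x 0) + fps_X * (\<Sum>y\<in>X - {x}. fps_const (k x y) * ?H y)"
    by (simp add: algebra_simps)
  have "rational_over ?S (fps_const (k x y) * ?H y)" if "y \<in> X - {x}" for y
  proof (cases "k x y = 0")
    case True
    then show ?thesis by (auto intro: rational_over_base S is_subring_0)
  next
    case False
    then show ?thesis using that k[of y] less.hyps[of y]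
      by (auto intro!: rational_over_mult S fps_const_in_fps_poly_over R)
  qed
  then have "rational_over ?S (\<Sum>y\<in>X - {x}. fps_const (k x y) * ?H y)"
    by (rule rational_over_sum[OF S])
  then have "rational_over ?S (?D * ?H x)"
    unfolding eq
    by (rule rational_over_add[OF S rational_over_base[OF S fps_const_in_fps_poly_over[OF R x(3)]]
        rational_over_mult[OF S fps_X_in_fps_poly_over[OF R]]])
  moreover have "?D \<in> ?S"
    using x k less.prems
    by (intro is_subring_intros S fps_const_in_fps_poly_over fps_X_in_fps_poly_over R) auto
  \<comment> \<open>The constant coefficient of \<open>?D\<close> is \<open>p x\<close>, whatever
    the diagonal entry is.\<close>
  moreover have "fps_nth ?D 0 \<noteq> 0" using x by simp
  then have "?D \<noteq> 0" by (metis fps_zero_nth)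
  ultimately show ?case using rational_over_cancel[OF S] by blast
qed

text \<open>In \<open>'a fps fps\<close>, \<open>fps_const\<close> embeds the series in the inner
  variable and \<open>fps_lift\<close> those in the outer one; a product of the two is a tensor of
  series in separate variables.\<close>

definition fps_lift :: "'a::comm_ring_1 fps \<Rightarrow> 'a fps fps" where
  "fps_lift F = Abs_fps (\<lambda>n. fps_const (fps_nth F n))"

lemma fps_nth_fps_lift [simp]: "fps_nth (fps_lift F) n = fps_const (fps_nth F n)"
  by (simp add: fps_lift_def)

lemma fps_const_sum: "fps_const (sum f A) = (\<Sum>x\<in>A. fps_const (f x))"
  by (induction A rule: infinite_finite_induct) (auto simp flip: fps_const_add)

lemma fps_lift_mult: "fps_lift (F * G) = fps_lift F * fps_lift G"
  by (rule fps_ext) (simp add: fps_mult_nth fps_const_sum)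

lemma fps_lift_sum: "fps_lift (sum f A) = (\<Sum>x\<in>A. fps_lift (f x))"
  by (rule fps_ext) (simp add: fps_sum_nth fps_const_sum)

lemma fps_lift_eq_0_iff [simp]: "fps_lift F = 0 \<longleftrightarrow> F = 0"
  by (auto simp: fps_eq_iff)

lemma fps_lift_in_fps_poly_over:
  assumes "is_subring R" "F \<in> fps_poly_over R"
  shows "fps_lift F \<in> fps_poly_over (fps_poly_over R)"
  using assms fps_const_in_fps_poly_over[OF assms(1)]
  by (auto simp: fps_poly_over_def[of "fps_poly_over R"]) (auto simp: fps_poly_over_def)

text \<open>Triangular systems in separate variables multiply coefficientwise in the common
  index \<open>d\<close>; this is why the Hadamard product in \<open>t\<close> stays rational.\<close>

lemma triangular_system_tensor:
  fixes R :: "'a::idom set"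
  assumes R: "is_subring R"
    and sys1: "triangular_system (fps_poly_over R) X r1 p k a"
    and sys2: "triangular_system (fps_poly_over R) Y r2 q l b"
  shows "triangular_system (fps_poly_over (fps_poly_over R)) (X \<times> Y)
    (\<lambda>(x, y). r1 x + r2 y)
    (\<lambda>(x, y). fps_const (p x) * fps_lift (q y))
    (\<lambda>(x, y) (x', y'). fps_const (k x x') * fps_lift (l y y'))
    (\<lambda>(x, y) d. fps_const (a x d) * fps_lift (b y d))"
proof -
  let ?S = "fps_poly_over (fps_poly_over R)"
  note S1 = is_subring_fps_poly_over[OF R]
  note S = is_subring_fps_poly_over[OF S1]
  have mem: "fps_const u * fps_lift v \<in> ?S" if "u \<in> fps_poly_over R" "v \<in> fps_poly_over R" for u v
    using that by (intro is_subring_mult S fps_const_in_fps_poly_over S1 fps_lift_in_fps_poly_over R)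
  have mult: "(fps_const u * fps_lift v) * (fps_const u' * fps_lift v') =
      fps_const (u * u') * fps_lift (v * v')" for u u' v v' :: "'a fps"
    by (simp add: fps_lift_mult algebra_simps flip: fps_const_mult)
  have rec: "fps_const (p x) * fps_lift (q y) * (fps_const (a x (Suc d)) * fps_lift (b y (Suc d))) =
      (\<Sum>(x', y')\<in>X \<times> Y. fps_const (k x x') * fps_lift (l y y') * (fps_const (a x' d) * fps_lift (b y' d)))"
    if "x \<in> X" "y \<in> Y" for x y d
  proof -
    have "p x * a x (Suc d) = (\<Sum>x'\<in>X. k x x' * a x' d)"
      "q y * b y (Suc d) = (\<Sum>y'\<in>Y. l y y' * b y' d)"
      using sys1 sys2 that unfolding triangular_system_def by blast+
    then show ?thesis
      by (simp only: mult fps_const_sum fps_lift_sum sum_product sum.cartesian_product)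
  qed
  \<comment> \<open>Each coordinate stays fixed or drops in rank, so the sum of the ranks drops
    unless both stay.\<close>
  have "k x x' \<noteq> 0 \<and> l y y' \<noteq> 0 \<Longrightarrow> (x', y') = (x, y) \<or> r1 x' + r2 y' < r1 x + r2 y"
    if "x \<in> X" "y \<in> Y" "x' \<in> X" "y' \<in> Y" for x y x' y'
  proof -
    assume "k x x' \<noteq> 0 \<and> l y y' \<noteq> 0"
    then have "x' = x \<or> r1 x' < r1 x" "y' = y \<or> r2 y' < r2 y"
      using sys1 sys2 that unfolding triangular_system_def by blast+
    then show ?thesis by auto
  qed
  then have tri: "fps_const (k x x') * fps_lift (l y y') \<noteq> 0 \<longrightarrow>
      (x', y') = (x, y) \<or> r1 x' + r2 y' < r1 x + r2 y"
    if "x \<in> X" "y \<in> Y" "x' \<in> X" "y' \<in> Y" for x y x' y' using that by simp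
  have elem: "p x \<in> fps_poly_over R" "p x \<noteq> 0" "p x * a x 0 \<in> fps_poly_over R"
    "x' \<in> X \<Longrightarrow> k x x' \<in> fps_poly_over R" if "x \<in> X" for x x'
    using sys1 that unfolding triangular_system_def by blast+
  have elem': "q y \<in> fps_poly_over R" "q y \<noteq> 0" "q y * b y 0 \<in> fps_poly_over R"
    "y' \<in> Y \<Longrightarrow> l y y' \<in> fps_poly_over R" if "y \<in> Y" for y y'
    using sys2 that unfolding triangular_system_def by blast+
  have "finite (X \<times> Y)" using sys1 sys2 unfolding triangular_system_def by blast
  then show ?thesis
    unfolding triangular_system_def[of ?S]
  proof (intro conjI ballI allI, goal_cases)
    case (2 z)
    then show ?case using elem(1) elem'(1) by (auto intro!: mem)
  next
    case (3 z)
    then show ?case using elem(2) elem'(2) by auto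
  next
    case (4 z)
    then show ?case using mem[OF elem(3) elem'(3)] by (cases z) (simp add: mult)
  next
    case (5 z z')
    then show ?case using elem(4) elem'(4) by (auto intro!: mem)
  next
    case (6 z z')
    then obtain x y x' y' where "z = (x, y)" "z' = (x', y')" "x \<in> X" "y \<in> Y" "x' \<in> X" "y' \<in> Y"
      by blast
    then show ?case using tri by (simp only: prod.case)
  next
    case (7 z d)
    then obtain x y where "z = (x, y)" "x \<in> X" "y \<in> Y" by blast
    then show ?case using rec[of x y d] by (simp only: prod.case case_prod_unfold fst_conv snd_conv)
  qed
qed

section \<open>Counting sums of edges\<close>

definition edges :: "nat \<Rightarrow> nat \<Rightarrow> (nat \<times> nat) set" where
  "edges c m = {(p, q). 1 \<le> p \<and> p \<le> m \<and> p \<le> q \<and> q \<le> p + c}"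

lemma finite_edges [simp]: "finite (edges c m)"
  by (rule finite_subset[of _ "{..m} \<times> {..m + c}"]) (auto simp: edges_def)

text \<open>A set of multisets identifies different decompositions with the same sum, as monomials
  do; its cardinality counts monomials, not factorizations.\<close>

primrec edge_sums :: "nat \<Rightarrow> nat \<Rightarrow> nat \<Rightarrow> nat multiset set" where
  "edge_sums c m 0 = {{#}}"
| "edge_sums c m (Suc d) = (\<lambda>((p, q), M). {#p, q#} + M) ` (edges c m \<times> edge_sums c m d)"

lemma edge_sums_SucI:
  "(p, q) \<in> edges c m \<Longrightarrow> M \<in> edge_sums c m d \<Longrightarrow> {#p, q#} + M \<in> edge_sums c m (Suc d)"
  by force

lemma edge_sums_SucE:
  assumes "M \<in> edge_sums c m (Suc d)"
  obtains p q M' where "(p, q) \<in> edges c m" "M' \<in> edge_sums c m d" "M = {#p, q#} + M'"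
  using assms by auto

declare edge_sums.simps(2) [simp del]

lemma finite_edge_sums [simp]: "finite (edge_sums c m d)"
  by (induction d) (auto simp: edge_sums.simps(2))

lemma size_edge_sums: "M \<in> edge_sums c m d \<Longrightarrow> size M = 2 * d"
  by (induction d arbitrary: M) (auto elim!: edge_sums_SucE)

text \<open>Edges of a decomposition commute: if the first edge misses \<open>z\<close>, induction
  exposes an edge at \<open>z\<close> in the rest, and the two are exchanged.\<close>

lemma edge_sums_remove_edge_at:
  assumes "M \<in> edge_sums c m (Suc d)" "z \<in># M"
  obtains p q M' where "(p, q) \<in> edges c m" "M' \<in> edge_sums c m d" "M = {#p, q#} + M'" "z = p \<or> z = q"
  using assms
proof (induction d arbitrary: M thesis)
  case 0
  then show ?case by (auto elim!: edge_sums_SucE)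
next
  case (Suc d)
  obtain p q M' where M: "(p, q) \<in> edges c m" "M' \<in> edge_sums c m (Suc d)" "M = {#p, q#} + M'"
    using Suc.prems(2) by (rule edge_sums_SucE)
  show ?case
  proof (cases "z = p \<or> z = q")
    case True
    then show ?thesis using Suc.prems(1) M by blast
  next
    case False
    then have "z \<in># M'" using Suc.prems(3) M by auto
    then obtain p' q' M'' where M': "(p', q') \<in> edges c m" "M'' \<in> edge_sums c m d"
      "M' = {#p', q'#} + M''" "z = p' \<or> z = q'"
      using Suc.IH M(2) by blast
    have "M = {#p', q'#} + ({#p, q#} + M'')" using M(3) M'(3) by simp
    then show ?thesis using Suc.prems(1) M'(1,4) edge_sums_SucI[OF M(1) M'(2)] by blast
  qed
qed

text \<open>For an edge \<open>(b, q)\<close>, these are the sums to which it can be added as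
  canonical last edge. Vertices beyond \<open>m\<close> are bounded by \<open>q\<close> only, as
  they cannot be left ends.\<close>

definition bounded_sums :: "nat \<Rightarrow> nat \<Rightarrow> nat \<Rightarrow> nat \<Rightarrow> nat \<Rightarrow> nat multiset set" where
  "bounded_sums c m d b q = {M \<in> edge_sums c m d. \<forall>z\<in>#M. z \<le> q \<and> (z \<le> m \<longrightarrow> z \<le> b)}"

lemma finite_bounded_sums [simp]: "finite (bounded_sums c m d b q)"
  by (simp add: bounded_sums_def)

lemma bounded_sums_0 [simp]: "bounded_sums c m 0 b q = {{#}}"
  by (auto simp: bounded_sums_def)

text \<open>The canonical last edge joins the largest vertex \<open>q\<close> of \<open>M\<close> to the largest remaining vertex
  \<open>b \<le> m\<close>. If \<open>q\<close> and \<open>b\<close> lie in different edges of a decomposition, the partners of \<open>q\<close> and \<open>b\<close>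
  can be joined to each other instead.\<close>

lemma edge_sums_canonical_edge:
  assumes M: "M \<in> edge_sums c m (Suc d)"
  obtains b q M' where "(b, q) \<in> edges c m" "M' \<in> bounded_sums c m d b q" "M = {#b, q#} + M'"
proof -
  define q where "q = Max (set_mset M)"
  have "set_mset M \<noteq> {}" using M by (auto elim!: edge_sums_SucE)
  then have q: "q \<in># M" and q_max: "\<And>z. z \<in># M \<Longrightarrow> z \<le> q"
    unfolding q_def by (auto intro!: Max_in)
  obtain p q' M1 where 1: "(p, q') \<in> edges c m" "M1 \<in> edge_sums c m d" "M = {#p, q'#} + M1" "q = p \<or> q = q'"
    using edge_sums_remove_edge_at[OF M q] by blast
  \<comment> \<open>Since \<open>p \<le> q'\<close>, an edge containing the maximum has it as right
    end.\<close>
  have "q' = q" using 1 q_max[of q'] by (auto simp: edges_def)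
  note 1 = 1[unfolded this]
  define B where "B = {z. z \<in># {#p#} + M1 \<and> z \<le> m}"
  define b where "b = Max B"
  have "finite B" by (auto simp: B_def)
  moreover have "p \<in> B" using 1 by (auto simp: B_def edges_def)
  ultimately have bB: "b \<in> B" and b_max: "\<And>z. z \<in> B \<Longrightarrow> z \<le> b"
    unfolding b_def by (auto intro!: Max_in)
  have pb: "p \<le> b" using b_max[OF \<open>p \<in> B\<close>] .
  have bq: "(b, q) \<in> edges c m" using 1 bB pb q_max[of b] by (auto simp: edges_def B_def)
  show thesis
  proof (cases "b = p")
    case True
    have "M1 \<in> bounded_sums c m d b q"
      using 1 q_max b_max by (auto simp: bounded_sums_def B_def)
    then show thesis using that[OF bq] 1 True by auto
  next
    case False
    then have "b \<in># M1" using bB by (auto simp: B_def)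
    moreover obtain d' where d: "d = Suc d'" using 1(2) \<open>b \<in># M1\<close> by (cases d) auto
    ultimately obtain x y M2 where 2: "(x, y) \<in> edges c m" "M2 \<in> edge_sums c m d'"
      "M1 = {#x, y#} + M2" "b = x \<or> b = y"
      using edge_sums_remove_edge_at 1(2) by blast
    define z where "z = (if b = x then y else x)"
    have M1: "M1 = {#b, z#} + M2" using 2 by (auto simp: z_def)
    have zb: "z \<le> m \<Longrightarrow> z \<le> b" and zq: "z \<le> q"
      using b_max[of z] q_max[of z] 1(3) M1 by (auto simp: B_def)
    \<comment> \<open>The exchange: if \<open>p \<le> z\<close>, then
      \<open>z \<le> q \<le> p + c\<close>; if \<open>z < p\<close>, then \<open>z\<close> is the
      left end of its edge with \<open>b\<close>, and \<open>p \<le> b \<le> z + c\<close>.\<close>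
    have "(min p z, max p z) \<in> edges c m"
      using 1(1) 2(1,4) zb zq pb bq by (auto simp: edges_def z_def min_def max_def split: if_splits)
    from edge_sums_SucI[OF this 2(2)] have "{#p, z#} + M2 \<in> edge_sums c m d"
      by (auto simp: d min_def max_def add_mset_commute split: if_splits)
    moreover have "v \<le> q \<and> (v \<le> m \<longrightarrow> v \<le> b)" if "v \<in># {#p, z#} + M2" for v
      using that q_max[of v] b_max[of v] 1(3) M1 by (auto simp: B_def)
    ultimately have "{#p, z#} + M2 \<in> bounded_sums c m d b q"
      by (auto simp: bounded_sums_def)
    moreover have "M = {#b, q#} + ({#p, z#} + M2)" using 1(3) M1 by simp
    ultimately show thesis using that[OF bq] by blast
  qed
qed

text \<open>Both ends can be read off from the sum: \<open>q\<close> is its maximum, and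
  \<open>b\<close> is the largest vertex in \<open>[m]\<close> once one copy of \<open>q\<close> is
  removed.\<close>

lemma canonical_edge_unique:
  assumes "(b, q) \<in> edges c m" "M \<in> bounded_sums c m d b q"
    and "(b', q') \<in> edges c m" "M' \<in> bounded_sums c m d b' q'"
    and eq: "{#b, q#} + M = {#b', q'#} + M'"
  shows "b = b' \<and> q = q' \<and> M = M'"
proof -
  have "q \<in># {#b', q'#} + M'" "q' \<in># {#b, q#} + M"
    by (subst eq[symmetric], simp) (subst eq, simp)
  then have q: "q = q'" using assms(1-4) by (force simp: edges_def bounded_sums_def)
  then have eq': "{#b#} + M = {#b'#} + M'" using eq by simp
  have "b \<in># {#b'#} + M'" "b' \<in># {#b#} + M"
    by (subst eq'[symmetric], simp) (subst eq', simp)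
  then have "b = b'" using assms(1-4) by (force simp: edges_def bounded_sums_def)
  then show ?thesis using q eq' by simp
qed

text \<open>Classification by the canonical last edge \<open>(b', q')\<close> is a disjoint union.
  Once that edge obeys the bounds \<open>b\<close> and \<open>q\<close>, so does the rest, which is
  bounded by \<open>b'\<close> and \<open>q'\<close>.\<close>

lemma card_bounded_sums_Suc:
  "card (bounded_sums c m (Suc d) b q) =
    (\<Sum>(b', q') | (b', q') \<in> edges c m \<and> q' \<le> q \<and> b' \<le> b \<and> (q' \<le> m \<longrightarrow> q' \<le> b).
      card (bounded_sums c m d b' q'))"
proof -
  let ?E = "{(b', q'). (b', q') \<in> edges c m \<and> q' \<le> q \<and> b' \<le> b \<and> (q' \<le> m \<longrightarrow> q' \<le> b)}"
  let ?A = "\<lambda>(b', q'). (\<lambda>M. {#b', q'#} + M) ` bounded_sums c m d b' q'"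
  have "bounded_sums c m (Suc d) b q = (\<Union>e\<in>?E. ?A e)"
  proof (intro equalityI subsetI)
    fix M assume M: "M \<in> bounded_sums c m (Suc d) b q"
    then have "M \<in> edge_sums c m (Suc d)" by (simp add: bounded_sums_def)
    then obtain b' q' M' where *: "(b', q') \<in> edges c m" "M' \<in> bounded_sums c m d b' q'"
      "M = {#b', q'#} + M'" by (rule edge_sums_canonical_edge)
    have "(b', q') \<in> ?E" using M * by (auto simp: bounded_sums_def edges_def)
    moreover have "M \<in> ?A (b', q')" using * by auto
    ultimately show "M \<in> (\<Union>e\<in>?E. ?A e)" by (rule UN_I)
  next
    fix M assume "M \<in> (\<Union>e\<in>?E. ?A e)"
    then obtain b' q' M' where *: "(b', q') \<in> ?E" "M' \<in> bounded_sums c m d b' q'"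
      "M = {#b', q'#} + M'" by auto
    have "M \<in> edge_sums c m (Suc d)"
      using * edge_sums_SucI[of b' q' c m M' d] by (auto simp: bounded_sums_def)
    then show "M \<in> bounded_sums c m (Suc d) b q"
      using * by (fastforce simp: bounded_sums_def edges_def)
  qed
  moreover have fin: "finite ?E" by (rule finite_subset[of _ "edges c m"]) auto
  have "card (\<Union>e\<in>?E. ?A e) = (\<Sum>e\<in>?E. card (?A e))"
  proof (rule card_UN_disjoint[OF fin])
    show "\<forall>e\<in>?E. finite (?A e)" by auto
    show "\<forall>e\<in>?E. \<forall>e'\<in>?E. e \<noteq> e' \<longrightarrow> ?A e \<inter> ?A e' = {}"
    proof (intro ballI impI)
      fix e e' assume "e \<in> ?E" "e' \<in> ?E" "e \<noteq> e'"
      moreover obtain b1 q1 b2 q2 where "e = (b1, q1)" "e' = (b2, q2)" by force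
      ultimately show "?A e \<inter> ?A e' = {}"
        using canonical_edge_unique[of b1 q1 c m _ d b2 q2] by auto
    qed
  qed
  moreover have "card (?A (b', q')) = card (bounded_sums c m d b' q')" for b' q'
    by (simp add: card_image inj_on_def)
  ultimately show ?thesis by (simp add: case_prod_unfold)
qed

section \<open>Recurrences relative to the ambient size \<open>m\<close>\<close>

lemma edge_sums_restrict:
  assumes "k \<le> m" "\<forall>z\<in>#M. z \<le> k"
  shows "M \<in> edge_sums c m d \<longleftrightarrow> M \<in> edge_sums c k d"
  using assms(2)
proof (induction d arbitrary: M)
  case (Suc d)
  show ?case
  proof
    assume "M \<in> edge_sums c m (Suc d)"
    then obtain p q M' where *: "(p, q) \<in> edges c m" "M' \<in> edge_sums c m d" "M = {#p, q#} + M'"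
      by (rule edge_sums_SucE)
    \<comment> \<open>Left ends are vertices themselves, hence at most \<open>k\<close>.\<close>
    then have "(p, q) \<in> edges c k" "M' \<in> edge_sums c k d"
      using Suc.IH[of M'] Suc.prems by (auto simp: edges_def)
    then show "M \<in> edge_sums c k (Suc d)" using *(3) edge_sums_SucI by blast
  next
    assume "M \<in> edge_sums c k (Suc d)"
    then obtain p q M' where *: "(p, q) \<in> edges c k" "M' \<in> edge_sums c k d" "M = {#p, q#} + M'"
      by (rule edge_sums_SucE)
    then have "(p, q) \<in> edges c m" "M' \<in> edge_sums c m d"
      using Suc.IH[of M'] Suc.prems assms(1) by (auto simp: edges_def)
    then show "M \<in> edge_sums c m (Suc d)" using *(3) edge_sums_SucI by blast
  qed
qed simp

text \<open>For \<open>q \<le> m\<close> no vertex exceeds \<open>m\<close>, so the bound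
  \<open>b\<close> applies to all of them and the ambient \<open>m\<close> can be replaced by
  \<open>b\<close>.\<close>

lemma bounded_sums_inner:
  assumes "b \<le> q" "q \<le> m"
  shows "bounded_sums c m d b q = bounded_sums c b d b b"
proof -
  have "bounded_sums c m d b q = {M \<in> edge_sums c m d. \<forall>z\<in>#M. z \<le> b}"
    using assms by (force simp: bounded_sums_def)
  also have "\<dots> = {M \<in> edge_sums c b d. \<forall>z\<in>#M. z \<le> b}"
    using edge_sums_restrict[of b m] assms by auto
  also have "\<dots> = bounded_sums c b d b b" by (auto simp: bounded_sums_def)
  finally show ?thesis .
qed

text \<open>Contribution of the last edges inside \<open>[k]\<close>. By
  \<open>bounded_sums_inner\<close> each summand depends on the left end only, not on the ambient
  \<open>m\<close>.\<close>

definition inner_count :: "nat \<Rightarrow> nat \<Rightarrow> nat \<Rightarrow> nat" where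
  "inner_count c d k = (\<Sum>(p, q) | (p, q) \<in> edges c k \<and> q \<le> k. card (bounded_sums c p d p p))"

text \<open>The last edges \<open>(m - i', m + j')\<close> that end beyond \<open>m\<close> and obey
  the bound \<open>(m - i, m + j)\<close>. The condition \<open>i' < m\<close> is kept out so that
  the set does not depend on \<open>m\<close>; for \<open>m \<le> i'\<close> the counts are set to 0
  instead.\<close>

definition crossings :: "nat \<Rightarrow> nat \<times> nat \<Rightarrow> (nat \<times> nat) set" where
  "crossings c = (\<lambda>(i, j). {(i', j'). i \<le> i' \<and> 1 \<le> j' \<and> j' \<le> j \<and> i' + j' \<le> c})"

lemma finite_crossings [simp]: "finite (crossings c x)"
  by (rule finite_subset[of _ "{..c} \<times> {..c}"]) (auto simp: crossings_def)

text \<open>A last edge either ends beyond \<open>m\<close>, or its right end is at most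
  \<open>m\<close> and the bound then forces the whole edge into \<open>[m - i]\<close>.\<close>

lemma card_bounded_sums_Suc_split:
  assumes "i < m"
  shows "card (bounded_sums c m (Suc d) (m - i) (m + j)) = inner_count c d (m - i) +
    (\<Sum>(i', j')\<in>crossings c (i, j). if m \<le> i' then 0 else card (bounded_sums c m d (m - i') (m + j')))"
proof -
  let ?f = "\<lambda>(b, q). card (bounded_sums c m d b q)"
  let ?I = "{(p, q). (p, q) \<in> edges c (m - i) \<and> q \<le> m - i}"
  let ?C = "{(i', j') \<in> crossings c (i, j). i' < m}"
  let ?h = "\<lambda>(i', j'). (m - i', m + j')"
  have "{(b', q'). (b', q') \<in> edges c m \<and> q' \<le> m + j \<and> b' \<le> m - i \<and> (q' \<le> m \<longrightarrow> q' \<le> m - i)} = ?I \<union> ?h ` ?C"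
    (is "?L = _")
  proof (intro equalityI subsetI)
    fix e assume e: "e \<in> ?L"
    obtain b q where bq: "e = (b, q)" by force
    show "e \<in> ?I \<union> ?h ` ?C"
    proof (cases "q \<le> m")
      case True
      then show ?thesis using e bq by (auto simp: edges_def)
    next
      case False
      then have "(m - b, q - m) \<in> ?C" "e = ?h (m - b, q - m)"
        using e bq by (auto simp: edges_def crossings_def)
      then show ?thesis by blast
    qed
  next
    fix e assume "e \<in> ?I \<union> ?h ` ?C"
    then show "e \<in> ?L" using assms by (auto simp: edges_def crossings_def)
  qed
  then have "card (bounded_sums c m (Suc d) (m - i) (m + j)) = sum ?f (?I \<union> ?h ` ?C)"
    by (simp add: card_bounded_sums_Suc)
  also have "\<dots> = sum ?f ?I + sum ?f (?h ` ?C)"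
  proof (rule sum.union_disjoint)
    show "finite ?I" by (rule finite_subset[of _ "edges c (m - i)"]) auto
    show "finite (?h ` ?C)" by (rule finite_imageI, rule finite_subset[of _ "crossings c (i, j)"]) auto
    show "?I \<inter> ?h ` ?C = {}" by (auto simp: crossings_def)
  qed
  also have "sum ?f ?I = inner_count c d (m - i)"
    unfolding inner_count_def
    by (rule sum.cong) (auto simp: edges_def intro!: arg_cong[of _ _ card] bounded_sums_inner)
  also have "sum ?f (?h ` ?C) = (\<Sum>(i', j')\<in>?C. card (bounded_sums c m d (m - i') (m + j')))"
    by (subst sum.reindex) (auto simp: inj_on_def crossings_def case_prod_unfold)
  also have "\<dots> = (\<Sum>(i', j')\<in>crossings c (i, j). if m \<le> i' then 0 else card (bounded_sums c m d (m - i') (m + j')))"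
    by (rule sum.mono_neutral_cong_left) (auto split: if_splits)
  finally show ?thesis .
qed

lemma inner_count_0 [simp]: "inner_count c d 0 = 0"
  unfolding inner_count_def by (rule sum.neutral) (auto simp: edges_def)

text \<open>The new edges end at \<open>Suc k\<close> and start at distance \<open>l \<le> c\<close>
  below; \<open>l \<le> k\<close> keeps the left end positive.\<close>

lemma inner_count_Suc:
  "inner_count c d (Suc k) = inner_count c d k + (\<Sum>l | l \<le> c \<and> l \<le> k. card (bounded_sums c (Suc k - l) d (Suc k - l) (Suc k - l)))"
proof -
  let ?I = "\<lambda>k. {(p, q). (p, q) \<in> edges c k \<and> q \<le> k}"
  let ?L = "{l. l \<le> c \<and> l \<le> k}"
  let ?h = "\<lambda>l. (Suc k - l, Suc k)"
  let ?f = "\<lambda>(p, q :: nat). card (bounded_sums c p d p p)"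
  have "?I (Suc k) = ?I k \<union> ?h ` ?L"
  proof (intro equalityI subsetI)
    fix e assume e: "e \<in> ?I (Suc k)"
    obtain p q where pq: "e = (p, q)" by force
    show "e \<in> ?I k \<union> ?h ` ?L"
    proof (cases "q \<le> k")
      case True
      then show ?thesis using e pq by (auto simp: edges_def)
    next
      case False
      then have "Suc k - p \<in> ?L" "e = ?h (Suc k - p)" using e pq by (auto simp: edges_def)
      then show ?thesis by blast
    qed
  qed (auto simp: edges_def)
  then have "inner_count c d (Suc k) = sum ?f (?I k \<union> ?h ` ?L)"
    by (simp add: inner_count_def)
  also have "\<dots> = sum ?f (?I k) + sum ?f (?h ` ?L)"
  proof (rule sum.union_disjoint)
    show "finite (?I k)" by (rule finite_subset[of _ "edges c k"]) auto
  qed auto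
  also have "sum ?f (?h ` ?L) = (\<Sum>l\<in>?L. card (bounded_sums c (Suc k - l) d (Suc k - l) (Suc k - l)))"
    by (subst sum.reindex) (auto simp: inj_on_def)
  finally show ?thesis by (simp add: inner_count_def)
qed

text \<open>The index \<open>(i, j)\<close> records the bounding edge \<open>(m - i, m + j)\<close> relative to \<open>m\<close>, so that the
  recurrence has finitely many states. In particular \<open>(0, 0)\<close> restricts to vertices in \<open>[m]\<close>, and
  \<open>(0, c)\<close> is no restriction at all.\<close>

definition bounded_series :: "nat \<Rightarrow> nat \<times> nat \<Rightarrow> nat \<Rightarrow> rat fps" where
  "bounded_series c = (\<lambda>(i, j) d. Abs_fps (\<lambda>m.
     if m \<le> i then 0 else of_nat (card (bounded_sums c m d (m - i) (m + j)))))"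

text \<open>Multiplication by \<open>1 - fps_X\<close> takes differences in \<open>k\<close>. By
  \<open>inner_count_Suc\<close> these are sums over a window of \<open>c + 1\<close> consecutive
  values of the state \<open>(0, 0)\<close>.\<close>

lemma inner_count_series:
  "(1 - fps_X) * Abs_fps (\<lambda>k. of_nat (inner_count c d k)) =
    (\<Sum>l\<le>c. fps_X ^ l) * bounded_series c (0, 0) d"
proof (rule fps_ext)
  fix n
  show "fps_nth ((1 - fps_X) * Abs_fps (\<lambda>k. of_nat (inner_count c d k))) n =
    fps_nth ((\<Sum>l\<le>c. fps_X ^ l) * bounded_series c (0, 0) d) n"
  proof (cases n)
    case 0
    then show ?thesis by (simp add: bounded_series_def)
  next
    case (Suc k)
    have "fps_nth ((\<Sum>l\<le>c. fps_X ^ l) * bounded_series c (0, 0) d) n =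
        (\<Sum>l\<le>c. if n < l then 0 else fps_nth (bounded_series c (0, 0) d) (n - l))"
      by (simp add: sum_distrib_right fps_sum_nth fps_X_power_mult_nth)
    \<comment> \<open>The coefficient of \<open>bounded_series\<close> at 0 is 0, which discards
      \<open>l = n\<close> and leaves \<open>l \<le> k\<close>.\<close>
    also have "\<dots> = (\<Sum>l | l \<le> c \<and> l \<le> k. of_nat (card (bounded_sums c (n - l) d (n - l) (n - l))))"
      by (rule sum.mono_neutral_cong_right) (auto simp: bounded_series_def Suc)
    finally show ?thesis using Suc by (simp add: algebra_simps inner_count_Suc)
  qed
qed

lemma bounded_series_Suc:
  "bounded_series c (i, j) (Suc d) = fps_X ^ i * Abs_fps (\<lambda>k. of_nat (inner_count c d k)) +
    (\<Sum>x\<in>crossings c (i, j). bounded_series c x d)"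
proof (rule fps_ext)
  fix m
  have "(if m \<le> i then 0 else of_nat (card (bounded_sums c m (Suc d) (m - i) (m + j)))) =
    (if m < i then 0 else of_nat (inner_count c d (m - i))) + (\<Sum>(i', j')\<in>crossings c (i, j).
      if m \<le> i' then 0 else of_nat (card (bounded_sums c m d (m - i') (m + j'))) :: rat)"
  proof (cases "m \<le> i")
    \<comment> \<open>All terms vanish: every crossing has \<open>i' \<ge> i \<ge> m\<close>, and
      for \<open>m = i\<close> the inner count is taken at 0.\<close>
    case True
    then have "(\<Sum>(i', j')\<in>crossings c (i, j).
      if m \<le> i' then 0 else of_nat (card (bounded_sums c m d (m - i') (m + j'))) :: rat) = 0"
      by (intro sum.neutral) (auto simp: crossings_def)
    then show ?thesis using True by simp
  next
    case False
    then show ?thesis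
      by (simp add: card_bounded_sums_Suc_split case_prod_unfold if_distrib cong: if_cong)
  qed
  then show "fps_nth (bounded_series c (i, j) (Suc d)) m =
    fps_nth (fps_X ^ i * Abs_fps (\<lambda>k. of_nat (inner_count c d k)) +
    (\<Sum>x\<in>crossings c (i, j). bounded_series c x d)) m"
    by (simp add: bounded_series_def fps_sum_nth fps_X_power_mult_nth case_prod_unfold split del: if_split cong: if_cong)
qed

text \<open>Only the empty sum is counted, once for each \<open>m > i\<close>: a geometric
  series.\<close>

lemma bounded_series_0: "(1 - fps_X) * bounded_series c (i, j) 0 = fps_X ^ Suc i"
proof (rule fps_ext)
  fix n
  show "fps_nth ((1 - fps_X) * bounded_series c (i, j) 0) n = fps_nth (fps_X ^ Suc i) n"
    by (cases n) (auto simp: bounded_series_def algebra_simps fps_X_power_iff simp del: power_Suc)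
qed

text \<open>The factor \<open>1 - fps_X\<close> eliminates \<open>inner_count\<close> in favour of
  the state \<open>(0, 0)\<close>. A crossing has \<open>i' \<ge> i\<close> and
  \<open>1 \<le> j' \<le> j\<close>, so \<open>j + (c - i)\<close> drops unless the state is
  unchanged; \<open>(0, 0)\<close> has no crossings and gets the lowest rank.\<close>

lemma triangular_system_bounded_series:
  "triangular_system (fps_poly_over UNIV) {(i, j). i + j \<le> c}
    (\<lambda>(i, j). if i + j = 0 then 0 else 1 + j + (c - i))
    (\<lambda>x. 1 - fps_X)
    (\<lambda>(i, j) x. (if x = (0, 0) then fps_X ^ i * (\<Sum>l\<le>c. fps_X ^ l) else 0) +
      (if x \<in> crossings c (i, j) then 1 - fps_X else 0))
    (bounded_series c)"
proof -
  let ?P = "fps_poly_over UNIV :: rat fps set"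
  let ?X = "{(i, j). i + j \<le> c}"
  let ?k = "\<lambda>(i, j) x. (if x = (0, 0) then fps_X ^ i * (\<Sum>l\<le>c. fps_X ^ l) else 0) +
      (if x \<in> crossings c (i, j) then 1 - fps_X else 0) :: rat fps"
  note P = is_subring_fps_poly_over[OF is_subring_UNIV]
  note X = fps_X_in_fps_poly_over[OF is_subring_UNIV]
  have fin: "finite ?X" by (rule finite_subset[of _ "{..c} \<times> {..c}"]) auto
  have poly: "1 - fps_X \<in> ?P" "fps_X ^ i \<in> ?P" "fps_X ^ i * (\<Sum>l\<le>c. fps_X ^ l) \<in> ?P" for i
    by (intro is_subring_intros P X)+
  have "fps_nth (1 - fps_X :: rat fps) 0 \<noteq> 0" by simp
  then have nz: "1 - fps_X \<noteq> (0 :: rat fps)" by (metis fps_zero_nth)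
  have rec: "(1 - fps_X) * bounded_series c (i, j) (Suc d) = (\<Sum>x\<in>?X. ?k (i, j) x * bounded_series c x d)" for i j d
  proof -
    have "(\<Sum>x\<in>?X. ?k (i, j) x * bounded_series c x d) =
      (\<Sum>x\<in>?X. if x = (0, 0) then fps_X ^ i * (\<Sum>l\<le>c. fps_X ^ l) * bounded_series c x d else 0) +
      (\<Sum>x\<in>?X. if x \<in> crossings c (i, j) then (1 - fps_X) * bounded_series c x d else 0)"
      by (subst sum.distrib[symmetric]) (rule sum.cong, auto simp: algebra_simps)
    also have "(\<Sum>x\<in>?X. if x = (0, 0) then fps_X ^ i * (\<Sum>l\<le>c. fps_X ^ l) * bounded_series c x d else 0) =
      fps_X ^ i * (\<Sum>l\<le>c. fps_X ^ l) * bounded_series c (0, 0) d"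
      using fin by (subst sum.delta) auto
    also have "(\<Sum>x\<in>?X. if x \<in> crossings c (i, j) then (1 - fps_X) * bounded_series c x d else 0) =
      (1 - fps_X) * (\<Sum>x\<in>crossings c (i, j). bounded_series c x d)"
      unfolding sum_distrib_left
      by (rule sum.mono_neutral_cong_right[OF fin]) (auto simp: crossings_def)
    finally show ?thesis
      by (simp add: bounded_series_Suc distrib_left mult.assoc flip: inner_count_series)
  qed
  show ?thesis
    unfolding triangular_system_def
  proof (intro conjI ballI allI, goal_cases)
    case 1
    show ?case by (rule fin)
  next
    case (2 x)
    show ?case by (rule poly)
  next
    case (3 x)
    show ?case by (rule nz)
  next
    case (4 x)
    show ?case by (cases x) (simp only: bounded_series_0 poly)
  next
    case (5 x y)
    show ?case using poly is_subring_add[OF P] is_subring_0[OF P] by (cases x) auto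
  next
    case (6 x y)
    then show ?case by (auto simp: crossings_def split: if_splits)
  next
    case (7 x d)
    show ?case using rec by (cases x) (simp only:)
  qed
qed

text \<open>Right ends are at most \<open>m + c\<close>, so the state \<open>(0, c)\<close> imposes
  nothing. The value 0 at \<open>m = 0\<close> differs from the true count only for
  \<open>d = 0\<close>.\<close>

lemma bounded_series_top:
  "fps_nth (bounded_series c (0, c) d) m = (if m = 0 then 0 else of_nat (card (edge_sums c m d)))"
proof -
  have "z \<le> m + c" if "M \<in> edge_sums c m d" "z \<in># M" for M z
    using that by (induction d arbitrary: M) (auto elim!: edge_sums_SucE simp: edges_def)
  then have "bounded_sums c m d m (m + c) = edge_sums c m d"
    by (auto simp: bounded_sums_def)
  then show ?thesis by (simp add: bounded_series_def)
qed

section \<open>Monomial bases of the graded pieces\<close>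

lemma lookup_pscale [simp]: "Poly_Mapping.lookup (pscale a p) \<mu> = a * Poly_Mapping.lookup p \<mu>"
  by (simp add: pscale_def Poly_Mapping.map.rep_eq when_def)

lemma vector_space_pscale: "vector_space (pscale :: 'k::field \<Rightarrow> 'k mpoly \<Rightarrow> 'k mpoly)"
  by unfold_locales (auto intro!: poly_mapping_eqI simp: lookup_add algebra_simps)

lemma span_monomials:
  fixes A :: "monom set"
  shows "module.span pscale ((\<lambda>\<mu>. Poly_Mapping.single \<mu> (1 :: 'k::field)) ` A) = {p. Poly_Mapping.keys p \<subseteq> A}"
    (is "module.span _ ?B = ?K")
proof -
  interpret vector_space "pscale :: 'k \<Rightarrow> 'k mpoly \<Rightarrow> 'k mpoly" by (rule vector_space_pscale)
  show ?thesis
  proof (intro equalityI subsetI)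
    have "Poly_Mapping.keys (pscale a p) \<subseteq> Poly_Mapping.keys p" for a :: 'k and p
      by (auto simp: in_keys_iff)
    then have "subspace ?K"
      unfolding subspace_def mem_Collect_eq
      by (auto dest!: subsetD[OF Poly_Mapping.keys_add])
    moreover have "?B \<subseteq> ?K" by auto
    ultimately have "span ?B \<subseteq> ?K" by (rule span_minimal[rotated])
    then show "p \<in> ?K" if "p \<in> span ?B" for p using that by (rule subsetD)
  next
    fix p assume p: "p \<in> ?K"
    have "p = (\<Sum>\<mu>\<in>Poly_Mapping.keys p. pscale (Poly_Mapping.lookup p \<mu>) (Poly_Mapping.single \<mu> 1))"
      (is "_ = ?s")
    proof (rule poly_mapping_eqI)
      fix \<nu>
      have "Poly_Mapping.lookup ?s \<nu> =
          (\<Sum>\<mu>\<in>Poly_Mapping.keys p. if \<mu> = \<nu> then Poly_Mapping.lookup p \<mu> else 0)"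
        unfolding lookup_sum by (rule sum.cong) (auto simp: lookup_single when_def)
      then show "Poly_Mapping.lookup p \<nu> = Poly_Mapping.lookup ?s \<nu>"
        by (simp add: in_keys_iff)
    qed
    also have "\<dots> \<in> span ?B"
    proof (rule span_sum)
      fix \<mu> assume "\<mu> \<in> Poly_Mapping.keys p"
      then have "Poly_Mapping.single \<mu> 1 \<in> ?B" using p by blast
      then show "pscale (Poly_Mapping.lookup p \<mu>) (Poly_Mapping.single \<mu> 1) \<in> span ?B"
        by (rule span_scale[OF span_base])
    qed
    finally show "p \<in> span ?B" .
  qed
qed

lemma dim_monomials:
  fixes A :: "monom set"
  shows "vector_space.dim pscale {p :: 'k::field mpoly. Poly_Mapping.keys p \<subseteq> A} = card A"
proof -
  interpret vector_space "pscale :: 'k \<Rightarrow> 'k mpoly \<Rightarrow> 'k mpoly" by (rule vector_space_pscale)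
  let ?m = "\<lambda>\<mu>. Poly_Mapping.single \<mu> (1 :: 'k) :: 'k mpoly"
  have inj: "inj_on ?m A"
  proof (rule inj_onI)
    fix \<mu> \<nu> assume "?m \<mu> = ?m \<nu>"
    then have "Poly_Mapping.keys (?m \<mu>) = Poly_Mapping.keys (?m \<nu>)" by (rule arg_cong)
    then show "\<mu> = \<nu>" by simp
  qed
  have "independent (?m ` A)"
    unfolding dependent_def
  proof (rule notI, elim bexE imageE)
    fix \<nu> \<mu> assume *: "\<nu> \<in> span (?m ` A - {\<nu>})" "\<nu> = ?m \<mu>" "\<mu> \<in> A"
    have "?m ` A - {?m \<mu>} = ?m ` (A - {\<mu>})" using inj *(3) by (auto simp: inj_on_def)
    then have "?m \<mu> \<in> {p. Poly_Mapping.keys p \<subseteq> A - {\<mu>}}"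
      using * by (simp add: span_monomials)
    then show False by simp
  qed
  then have "dim (span (?m ` A)) = card (?m ` A)" by (rule dim_span_eq_card_independent)
  then show ?thesis by (simp add: span_monomials card_image[OF inj])
qed

section \<open>Monomials of the Segre product\<close>

definition vertex_monom :: "nat multiset \<Rightarrow> nat multiset \<Rightarrow> monom" where
  "vertex_monom M N = (\<Sum>z\<in>#M. Poly_Mapping.single (Inl z) 1) + (\<Sum>z\<in>#N. Poly_Mapping.single (Inr z) 1)"

lemma vertex_monom_add:
  "vertex_monom (M + M') (N + N') = vertex_monom M N + vertex_monom M' N'"
  by (simp add: vertex_monom_def algebra_simps)

lemma lookup_vertex_monom:
  "Poly_Mapping.lookup (vertex_monom M N) (Inl z) = count M z"
  "Poly_Mapping.lookup (vertex_monom M N) (Inr z) = count N z"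
proof -
  have "Poly_Mapping.lookup (\<Sum>z\<in>#M. Poly_Mapping.single (f z) 1 :: monom) v = count (image_mset f M) v"
    for f :: "nat \<Rightarrow> nat + nat" and M v by (induction M) (auto simp: lookup_add lookup_single when_def)
  moreover have "count (image_mset f M) (f z) = count M z" if "inj f" for f :: "nat \<Rightarrow> nat + nat" and M z
    using that by (induction M) (auto dest: injD)
  moreover have "count (image_mset Inl M) (Inr z) = 0" "count (image_mset Inr N) (Inl z) = 0"
    by (auto simp: count_eq_zero_iff)
  ultimately show "Poly_Mapping.lookup (vertex_monom M N) (Inl z) = count M z"
    "Poly_Mapping.lookup (vertex_monom M N) (Inr z) = count N z"
    by (simp_all add: vertex_monom_def lookup_add del: One_nat_def)
qed

lemma vertex_monom_inject: "vertex_monom M N = vertex_monom M' N' \<longleftrightarrow> M = M' \<and> N = N'"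
  by (metis lookup_vertex_monom multiset_eqI)

lemma mdeg_superset:
  assumes "finite S" "Poly_Mapping.keys \<alpha> \<subseteq> S"
  shows "mdeg \<alpha> = (\<Sum>v\<in>S. Poly_Mapping.lookup \<alpha> v)"
  unfolding mdeg_def using assms by (intro sum.mono_neutral_left) (auto simp: in_keys_iff)

lemma mdeg_add: "mdeg (\<alpha> + \<beta>) = mdeg \<alpha> + mdeg \<beta>"
proof -
  let ?S = "Poly_Mapping.keys \<alpha> \<union> Poly_Mapping.keys \<beta>"
  have "mdeg (\<alpha> + \<beta>) = (\<Sum>v\<in>?S. Poly_Mapping.lookup (\<alpha> + \<beta>) v)"
    by (rule mdeg_superset) (auto simp: in_keys_iff lookup_add)
  then show ?thesis
    using mdeg_superset[of ?S \<alpha>] mdeg_superset[of ?S \<beta>] by (simp add: lookup_add sum.distrib)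
qed

lemma mdeg_vertex_monom: "mdeg (vertex_monom M N) = size M + size N"
proof -
  have [simp]: "mdeg 0 = 0" "mdeg (Poly_Mapping.single v 1) = 1" for v
    by (simp_all add: mdeg_def)
  have "mdeg (\<Sum>z\<in>#M. Poly_Mapping.single (f z) 1) = size M" for f :: "nat \<Rightarrow> nat + nat" and M
    by (induction M) (simp_all add: mdeg_add del: One_nat_def)
  then show ?thesis by (simp add: vertex_monom_def mdeg_add del: One_nat_def)
qed

text \<open>Each Segre generator uses one edge on either side, so both sums have the same number
  \<open>d\<close> of edges.\<close>

definition segre_monoms :: "nat \<Rightarrow> nat \<Rightarrow> nat \<Rightarrow> nat \<Rightarrow> nat \<Rightarrow> monom set" where
  "segre_monoms c c' m n d = (\<lambda>(M, N). vertex_monom M N) ` (edge_sums c m d \<times> edge_sums c' n d)"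

lemma card_segre_monoms:
  "card (segre_monoms c c' m n d) = card (edge_sums c m d) * card (edge_sums c' n d)"
  unfolding segre_monoms_def
  by (subst card_image) (auto simp: inj_on_def vertex_monom_inject card_cartesian_product)

lemma genSegre_eq:
  "genSegre c c' m n = {Poly_Mapping.single (vertex_monom {#p, q#} {#p', q'#}) (1 :: 'k::field) | p q p' q'.
     (p, q) \<in> edges c m \<and> (p', q') \<in> edges c' n}"
proof -
  have eq: "quad (Inl p) (Inl q) * quad (Inr p') (Inr q') =
      (Poly_Mapping.single (vertex_monom {#p, q#} {#p', q'#}) 1 :: 'k mpoly)" for p q p' q'
    by (simp add: quad_def mult_single vertex_monom_def add_ac)
  have A: "genA c m = {quad (Inl p) (Inl q) :: 'k mpoly | p q. (p, q) \<in> edges c m}"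
    and B: "genB c' n = {quad (Inr p) (Inr q) :: 'k mpoly | p q. (p, q) \<in> edges c' n}"
    by (auto simp: genA_def genB_def edges_def)
  show ?thesis unfolding genSegre_def A B eq[symmetric] by blast
qed

text \<open>A product of \<open>d\<close> generators splits into \<open>d\<close> edges on each
  side; conversely, two decompositions of equal length can be paired off termwise in any
  order.\<close>

lemma prod_lists_genSegre:
  "{prod_list l | l. set l \<subseteq> genSegre c c' m n} =
    (\<lambda>\<mu>. Poly_Mapping.single \<mu> (1 :: 'k::field)) ` (\<Union>d. segre_monoms c c' m n d)"
    (is "?L = ?m ` ?U")
proof (intro equalityI subsetI)
  have "\<exists>\<mu>\<in>segre_monoms c c' m n (length l). prod_list l = ?m \<mu>" if "set l \<subseteq> genSegre c c' m n" for l
    using that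
  proof (induction l)
    case Nil
    then show ?case by (simp add: segre_monoms_def vertex_monom_def)
  next
    case (Cons g l)
    then obtain M N where *: "M \<in> edge_sums c m (length l)" "N \<in> edge_sums c' n (length l)"
      "prod_list l = ?m (vertex_monom M N)"
      by (auto simp: segre_monoms_def)
    from Cons.prems obtain p q p' q' where g: "(p, q) \<in> edges c m" "(p', q') \<in> edges c' n"
      "g = ?m (vertex_monom {#p, q#} {#p', q'#})"
      by (auto simp: genSegre_eq)
    have "prod_list (g # l) = ?m (vertex_monom ({#p, q#} + M) ({#p', q'#} + N))"
      by (simp only: prod_list.Cons g(3) *(3) mult_single vertex_monom_add mult_1)
    moreover have "vertex_monom ({#p, q#} + M) ({#p', q'#} + N) \<in> segre_monoms c c' m n (length (g # l))"
      using edge_sums_SucI[OF g(1) *(1)] edge_sums_SucI[OF g(2) *(2)]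
      by (force simp: segre_monoms_def)
    ultimately show ?case by blast
  qed
  then show "x \<in> ?m ` ?U" if "x \<in> ?L" for x using that by blast
next
  have *: "\<exists>l. set l \<subseteq> genSegre c c' m n \<and> prod_list l = ?m (vertex_monom M N)"
    if "M \<in> edge_sums c m d" "N \<in> edge_sums c' n d" for M N d
    using that
  proof (induction d arbitrary: M N)
    case 0
    then show ?case by (intro exI[of _ "[]"]) (simp add: vertex_monom_def)
  next
    case (Suc d)
    obtain p q M1 where M: "(p, q) \<in> edges c m" "M1 \<in> edge_sums c m d" "M = {#p, q#} + M1"
      using Suc.prems(1) by (rule edge_sums_SucE)
    obtain p' q' N1 where N: "(p', q') \<in> edges c' n" "N1 \<in> edge_sums c' n d" "N = {#p', q'#} + N1"
      using Suc.prems(2) by (rule edge_sums_SucE)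
    obtain l where l: "set l \<subseteq> genSegre c c' m n" "prod_list l = ?m (vertex_monom M1 N1)"
      using Suc.IH M N by blast
    let ?g = "?m (vertex_monom {#p, q#} {#p', q'#})"
    have "?g \<in> genSegre c c' m n" unfolding genSegre_eq using M N by blast
    moreover have "prod_list (?g # l) = ?m (vertex_monom M N)"
      by (simp only: prod_list.Cons l(2) M(3) N(3) mult_single vertex_monom_add mult_1)
    ultimately show ?case using l by (intro exI[of _ "?g # l"]) auto
  qed
  show "x \<in> ?L" if x: "x \<in> ?m ` ?U" for x
  proof -
    obtain d M N where "M \<in> edge_sums c m d" "N \<in> edge_sums c' n d" "x = ?m (vertex_monom M N)"
      using x by (auto simp: segre_monoms_def)
    moreover from this obtain l where "set l \<subseteq> genSegre c c' m n" "prod_list l = ?m (vertex_monom M N)"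
      using * by blast
    ultimately have "x = prod_list l \<and> set l \<subseteq> genSegre c c' m n" by simp
    then show ?thesis by blast
  qed
qed

text \<open>A product of \<open>e\<close> generators has degree \<open>4 * e\<close>, so the degree
  condition selects exactly the monomials with \<open>e = d\<close>, and these form a basis.\<close>

lemma segre_hilb_eq:
  "segre_hilb TYPE('k::field) c c' m n d = card (edge_sums c m d) * card (edge_sums c' n d)"
proof -
  have deg: "mdeg \<mu> = 4 * e" if "\<mu> \<in> segre_monoms c c' m n e" for \<mu> e
    using that by (auto simp: segre_monoms_def mdeg_vertex_monom size_edge_sums)
  have "(segre_part c c' m n d :: 'k mpoly set) =
      {p. Poly_Mapping.keys p \<subseteq> (\<Union>e. segre_monoms c c' m n e) \<and> (\<forall>\<mu>\<in>Poly_Mapping.keys p. mdeg \<mu> = 4 * d)}"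
    by (simp add: segre_part_def subalg_def prod_lists_genSegre span_monomials)
  also have "\<dots> = {p. Poly_Mapping.keys p \<subseteq> segre_monoms c c' m n d}"
    using deg by fastforce
  finally show ?thesis by (simp add: segre_hilb_def dim_monomials card_segre_monoms)
qed

section \<open>Rationality\<close>

text \<open>Serves to repair the coefficient of t^0, where \<open>bounded_series\<close> omits
  \<open>m = 0\<close>.\<close>

lemma Abs_fps_eq_add_const:
  assumes "\<And>d. d > 0 \<Longrightarrow> h d = h' d"
  shows "Abs_fps h = Abs_fps h' + fps_const (h 0 - h' 0 :: 'a::comm_ring_1)"
proof (rule fps_ext)
  fix n show "fps_nth (Abs_fps h) n = fps_nth (Abs_fps h' + fps_const (h 0 - h' 0)) n"
    using assms by (cases n) simp_all
qed

lemma finite_support_fps_poly_over3: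
  assumes "F \<in> fps_poly_over (fps_poly_over (fps_poly_over R))"
  shows "finite {(i, j, k). fps_nth (fps_nth (fps_nth F k) j) i \<noteq> 0}"
proof -
  let ?T = "SIGMA k:{k. fps_nth F k \<noteq> 0}. SIGMA j:{j. fps_nth (fps_nth F k) j \<noteq> 0}.
    {i. fps_nth (fps_nth (fps_nth F k) j) i \<noteq> 0}"
  have "finite ?T" using assms by (auto simp: fps_poly_over_def)
  then have "finite ((\<lambda>(k, j, i). (i, j, k)) ` ?T)" by (rule finite_imageI)
  moreover have "{(i, j, k). fps_nth (fps_nth (fps_nth F k) j) i \<noteq> 0} \<subseteq> (\<lambda>(k, j, i). (i, j, k)) ` ?T"
    by force
  ultimately show ?thesis by (rule finite_subset[rotated])
qed

text \<open>The nesting order is t outermost, then s2, then s1; the convolution in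
  \<open>rational_series3\<close> is the nested Cauchy product with its sums reordered.\<close>

lemma rational_series3I:
  fixes F :: "rat fps fps fps"
  assumes "rational_over (fps_poly_over (fps_poly_over (fps_poly_over UNIV))) F"
  shows "rational_series3 (\<lambda>m n d. fps_nth (fps_nth (fps_nth F d) n) m)"
proof -
  obtain Q where Q: "Q \<in> fps_poly_over (fps_poly_over (fps_poly_over UNIV))" "Q \<noteq> 0"
    "Q * F \<in> fps_poly_over (fps_poly_over (fps_poly_over UNIV))"
    using assms by (auto simp: rational_over_def)
  let ?c = "\<lambda>(F :: rat fps fps fps) i j k. fps_nth (fps_nth (fps_nth F k) j) i"
  have "\<exists>i j k. ?c Q i j k \<noteq> 0" using Q(2) by (auto simp: fps_eq_iff)
  moreover have "(\<Sum>i\<le>m. \<Sum>j\<le>n. \<Sum>k\<le>d. ?c Q i j k * ?c F (m - i) (n - j) (d - k)) = ?c (Q * F) m n d" for m n d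
  proof -
    have "?c (Q * F) m n d = (\<Sum>k\<le>d. \<Sum>j\<le>n. \<Sum>i\<le>m. ?c Q i j k * ?c F (m - i) (n - j) (d - k))"
      by (simp add: fps_mult_nth fps_sum_nth atLeast0AtMost)
    also have "\<dots> = (\<Sum>k\<le>d. \<Sum>i\<le>m. \<Sum>j\<le>n. ?c Q i j k * ?c F (m - i) (n - j) (d - k))"
      by (rule sum.cong[OF refl], rule sum.swap)
    also have "\<dots> = (\<Sum>i\<le>m. \<Sum>k\<le>d. \<Sum>j\<le>n. ?c Q i j k * ?c F (m - i) (n - j) (d - k))"
      by (rule sum.swap)
    also have "\<dots> = (\<Sum>i\<le>m. \<Sum>j\<le>n. \<Sum>k\<le>d. ?c Q i j k * ?c F (m - i) (n - j) (d - k))"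
      by (rule sum.cong[OF refl], rule sum.swap)
    finally show ?thesis ..
  qed
  ultimately show ?thesis
    unfolding rational_series3_def
    using finite_support_fps_poly_over3[OF Q(1)] finite_support_fps_poly_over3[OF Q(3)]
    by (intro exI[of _ "?c (Q * F)"] exI[of _ "?c Q"]) blast
qed

theorem theorem5p5:
  fixes c c' :: nat
  shows "rational_series3 (\<lambda>m n d. of_nat (segre_hilb TYPE('k::field) c c' m n d))"
proof -
  let ?P = "fps_poly_over (UNIV :: rat set)"
  let ?P2 = "fps_poly_over ?P"
  let ?P3 = "fps_poly_over ?P2"
  note P = is_subring_fps_poly_over[OF is_subring_UNIV]
  note P2 = is_subring_fps_poly_over[OF P]
  note P3 = is_subring_fps_poly_over[OF P2]
  let ?a = "\<lambda>c d. Abs_fps (\<lambda>m. of_nat (card (edge_sums c m d))) :: rat fps"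
  let ?g = "\<lambda>c. bounded_series c (0, c)"
  let ?h = "\<lambda>d. fps_const (?a c d) * fps_lift (?a c' d)"
  let ?h' = "\<lambda>d. fps_const (?g c d) * fps_lift (?g c' d)"
  let ?u = "1 - fps_X :: rat fps"
  let ?p = "fps_const ?u * fps_lift ?u"
  have "fps_nth (fps_nth ?p 0) 0 \<noteq> 0" by simp
  then have nz: "?p \<noteq> 0" by (metis fps_zero_nth)
  have u: "?u \<in> ?P" by (intro is_subring_intros P fps_X_in_fps_poly_over is_subring_UNIV)
  have tensor: "fps_const x * fps_lift y \<in> ?P2" if "x \<in> ?P" "y \<in> ?P" for x y
    using that
    by (intro is_subring_mult P2 fps_const_in_fps_poly_over P fps_lift_in_fps_poly_over is_subring_UNIV)
  have tensor_mult: "?p * (fps_const x * fps_lift y) = fps_const (?u * x) * fps_lift (?u * y)" for x y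
    by (simp only: fps_lift_mult fps_const_mult[symmetric] mult_ac)
  \<comment> \<open>The states \<open>(0, c)\<close> and \<open>(0, c')\<close> are the unrestricted
    ones.\<close>
  have rat': "rational_over ?P3 (Abs_fps ?h')"
    using triangular_system_rational[OF P2
        triangular_system_tensor[OF is_subring_UNIV
          triangular_system_bounded_series[of c] triangular_system_bounded_series[of c']],
        of "((0, c), (0, c'))"]
    by simp
  have a0: "?u * ?a c 0 = 1" for c
  proof (rule fps_ext)
    fix n show "fps_nth (?u * ?a c 0) n = fps_nth 1 n" by (cases n) (simp_all add: algebra_simps)
  qed
  have "?g c d = ?a c d" if "d > 0" for c d
  proof (rule fps_ext)
    fix m
    \<comment> \<open>For \<open>d > 0\<close> an edge is needed, and \<open>[0]\<close> offers no
      left end; so both series vanish at \<open>m = 0\<close>.\<close>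
    have "edge_sums c 0 d = {}" using that by (cases d) (auto elim!: edge_sums_SucE simp: edges_def)
    then show "fps_nth (?g c d) m = fps_nth (?a c d) m" by (simp add: bounded_series_top)
  qed
  then have "?h d = ?h' d" if "d > 0" for d using that by simp
  then have eq: "Abs_fps ?h = Abs_fps ?h' + fps_const (?h 0 - ?h' 0)"
    by (rule Abs_fps_eq_add_const)
  \<comment> \<open>At \<open>d = 0\<close> the two series are 1 / ((1 - s1)(1 - s2)) and s1 s2 /
    ((1 - s1)(1 - s2)), so \<open>?p\<close> clears both denominators.\<close>
  have "?p * ?h 0 \<in> ?P2" "?p * ?h' 0 \<in> ?P2"
    unfolding tensor_mult a0 bounded_series_0
    by (intro tensor is_subring_1[OF P] is_subring_power[OF P] fps_X_in_fps_poly_over is_subring_UNIV)+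
  then have "?p * (?h 0 - ?h' 0) \<in> ?P2" unfolding right_diff_distrib by (rule is_subring_diff[OF P2])
  then have "fps_const ?p * fps_const (?h 0 - ?h' 0) \<in> ?P3"
    unfolding fps_const_mult by (rule fps_const_in_fps_poly_over[OF P2])
  moreover have "fps_const ?p \<in> ?P3"
    by (intro fps_const_in_fps_poly_over P2 tensor u)
  moreover have "fps_const ?p \<noteq> 0" using nz by (simp only: fps_const_eq_0_iff not_False_eq_True)
  ultimately have "rational_over ?P3 (fps_const (?h 0 - ?h' 0))"
    unfolding rational_over_def by blast
  with rat' have "rational_over ?P3 (Abs_fps ?h)"
    unfolding eq by (rule rational_over_add[OF P3])
  then have "rational_series3 (\<lambda>m n d. fps_nth (fps_nth (fps_nth (Abs_fps ?h) d) n) m)"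
    by (rule rational_series3I)
  then show ?thesis by (simp add: segre_hilb_eq)
qed

end
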